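(* Let $\eta\in\{-1,1\}$ and let $I\subset\mathbb{R}$ be an open interval with $0\in I$. Let $\lambda(s)=(0,y(s),z(s))$, $s\in I$, be a $C^2$ curve with $y>z$ and $y'^2-z'^2=\eta$, and suppose that the surface of revolution in $\mathbb{E}_1^3$ obtained by rotating $\lambda$ around the lightlike axis spanned by $(0,1,1)$ has mean curvature $H(s)$, where $H:I\to\mathbb{R}$ is continuous. Then there exist constants $a_0,a_1,b_0,b_1\in\mathbb{R}$ such that, for all $s\in I$, with $$a(s)=\sqrt{a_1+a_0\int_0^s\exp\Big(-2\eta\int_0^uH(t)\,dt\Big)du}\,,$$ one has $$y(s)=\frac12\Big(b_1+a(s)+b_0\int_0^s a(u)\exp\Big(2\eta\int_0^uH(t)\,dt\Big)du\Big),$$ $$z(s)=\frac12\Big(b_1-a(s)+b_0\int_0^s a(u)\exp\Big(2\eta\int_0^uH(t)\,dt\Big)du\Big).$$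
   Context: $\mathbb{E}_1^3$ is $\mathbb{R}^3$ with coordinates $(x,y,z)$ and the metric $\langle u,v\rangle=u_1v_1+u_2v_2-u_3v_3$. Rotating $\lambda(s)=(0,y(s),z(s))$, $y>z$, around the lightlike axis $(0,1,1)$ gives the surface $$L(s,\theta)=\Big([y(s)-z(s)]\theta,\;y(s)-\tfrac{\theta^2}{2}[y(s)-z(s)],\;z(s)-\tfrac{\theta^2}{2}[y(s)-z(s)]\Big),\quad\theta\in\mathbb{R},$$ with unit normal chosen as $N=\big(-(y'-z')\theta,\;z'+\tfrac{\theta^2}{2}(y'-z'),\;y'+\tfrac{\theta^2}{2}(y'-z')\big)$. For a non-lightlike parametrized surface $X(u,v)$ with unit normal $N$, put $\epsilon=\langle N,N\rangle\in\{-1,1\}$, let $g_{11}=\langle X_u,X_u\rangle$, $g_{12}=\langle X_u,X_v\rangle$, $g_{22}=\langle X_v,X_v\rangle$, $h_{11}=\langle X_{uu},N\rangle$, $h_{12}=\langle X_{uv},N\rangle$, $h_{22}=\langle X_{vv},N\rangle$. The mean curvature is $$H=\frac{\epsilon}{2}\,\frac{g_{11}h_{22}-2g_{12}h_{12}+g_{22}h_{11}}{g_{11}g_{22}-g_{12}^2}.$$ Here $\epsilon=-\eta$ and $H$ depends only on $s$. *)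

theory Defs
  imports "HOL-Analysis.Analysis"
begin

definition lorentz_inner :: "real ^ 3 \<Rightarrow> real ^ 3 \<Rightarrow> real" where
  "lorentz_inner u v = u $ 1 * v $ 1 + u $ 2 * v $ 2 - u $ 3 * v $ 3"

(* Meant for open S, where the two-sided derivative "at t" is the right one. *)
definition C2_differentiable_on :: "(real \<Rightarrow> 'a::real_normed_vector) \<Rightarrow> real set \<Rightarrow> bool"
    (infix "C2'_differentiable'_on" 50) where
  "f C2_differentiable_on S \<longleftrightarrow>
     f C1_differentiable_on S \<and> (\<lambda>t. vector_derivative f (at t)) C1_differentiable_on S"

type_synonym psurface = "real \<Rightarrow> real \<Rightarrow> real ^ 3"

definition partial1 :: "psurface \<Rightarrow> psurface" where
  "partial1 X u v = vector_derivative (\<lambda>t. X t v) (at u)"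

definition partial2 :: "psurface \<Rightarrow> psurface" where
  "partial2 X u v = vector_derivative (\<lambda>t. X u t) (at v)"

(* N is the chosen unit normal field along X; the sign of the result depends on that choice. *)
definition mean_curvature :: "psurface \<Rightarrow> psurface \<Rightarrow> real \<Rightarrow> real \<Rightarrow> real" where
  "mean_curvature X N u v =
     (let n = N u v;
          Xu = partial1 X u v;
          Xv = partial2 X u v;
          eps = lorentz_inner n n;
          g11 = lorentz_inner Xu Xu;
          g12 = lorentz_inner Xu Xv;
          g22 = lorentz_inner Xv Xv;
          h11 = lorentz_inner (partial1 (partial1 X) u v) n;
          h12 = lorentz_inner (partial2 (partial1 X) u v) n;
          h22 = lorentz_inner (partial2 (partial2 X) u v) n
      in eps / 2 * ((g11 * h22 - 2 * g12 * h12 + g22 * h11) / (g11 * g22 - g12\<^sup>2)))"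

(* The orbit of the profile curve (0, y, z) under the one-parameter group of Lorentz
   isometries fixing (0, 1, 1). *)
definition lightlike_rotation_surface :: "(real \<Rightarrow> real) \<Rightarrow> (real \<Rightarrow> real) \<Rightarrow> psurface" where
  "lightlike_rotation_surface y z s \<theta> =
     vector [(y s - z s) * \<theta>,
             y s - \<theta>\<^sup>2 / 2 * (y s - z s),
             z s - \<theta>\<^sup>2 / 2 * (y s - z s)]"

definition lightlike_rotation_normal :: "(real \<Rightarrow> real) \<Rightarrow> (real \<Rightarrow> real) \<Rightarrow> psurface" where
  "lightlike_rotation_normal y z s \<theta> =
     vector [- (deriv y s - deriv z s) * \<theta>,
             deriv z s + \<theta>\<^sup>2 / 2 * (deriv y s - deriv z s),
             deriv y s + \<theta>\<^sup>2 / 2 * (deriv y s - deriv z s)]"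

end

theory Submission
  imports Defs
begin

text \<open>In the null coordinates \<open>a = y - z\<close>, \<open>b = y + z\<close> the unit speed condition reads \<open>a' b' = \<eta>\<close>.
  Evaluated on the profile curve \<open>\<theta> = 0\<close>, the mean curvature equation becomes
  \<open>(ln \<bar>a a'\<bar>)' = - 2 \<eta> H\<close>, so \<open>a a' = c exp (- 2 \<eta> \<integral>H)\<close> with \<open>c \<noteq> 0\<close>. Integrating once gives \<open>a\<^sup>2\<close>,
  and integrating \<open>b' = \<eta> / a' = (\<eta> / c) a exp (2 \<eta> \<integral>H)\<close> gives \<open>b\<close>.\<close>

text \<open>Written as a combination of fixed basis vectors, a triple can be differentiated
  coordinate by coordinate through sums and bounded linear maps.\<close>

lemma vector_3_eq: "(vector [a, b, c] :: real ^ 3) = a *\<^sub>R axis 1 1 + b *\<^sub>R axis 2 1 + c *\<^sub>R axis 3 1"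
  by (simp add: vec_eq_iff forall_3 axis_def)

lemma has_vector_derivative_vector_3:
  fixes f g h :: "real \<Rightarrow> real"
  assumes "(f has_real_derivative f') F" "(g has_real_derivative g') F" "(h has_real_derivative h') F"
  shows "((\<lambda>t. vector [f t, g t, h t] :: real ^ 3) has_vector_derivative vector [f', g', h']) F"
  unfolding vector_3_eq
  using assms unfolding has_real_derivative_iff_has_vector_derivative
  by (intro has_vector_derivative_add bounded_linear.has_vector_derivative[OF bounded_linear_scaleR_left])

text \<open>Links the regularity notion, phrased with \<open>vector_derivative\<close>, to the
  \<open>deriv\<close> used in the unit speed condition. The two derivatives agree at every point of
  the open set \<open>S\<close>, hence near \<open>s\<close>, so differentiability passes from one
  to the other.\<close>

lemma C2_differentiable_on_real_derivatives:
  fixes f :: "real \<Rightarrow> real"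
  assumes "f C2_differentiable_on S" "open S" "s \<in> S"
  shows "(f has_real_derivative deriv f s) (at s)"
    and "(deriv f has_real_derivative deriv (deriv f) s) (at s)"
proof -
  have eq: "vector_derivative f (at t) = deriv f t" and D: "(f has_real_derivative deriv f t) (at t)"
    if "t \<in> S" for t
  proof -
    have "f differentiable at t"
      using assms(1) that by (simp add: C2_differentiable_on_def C1_differentiable_on_eq)
    then have d: "(f has_vector_derivative vector_derivative f (at t)) (at t)"
      by (simp only: vector_derivative_works)
    then show "vector_derivative f (at t) = deriv f t"
      by (simp only: DERIV_imp_deriv flip: has_real_derivative_iff_has_vector_derivative)
    with d show "(f has_real_derivative deriv f t) (at t)"
      by (simp only: has_real_derivative_iff_has_vector_derivative)
  qed
  show "(f has_real_derivative deriv f s) (at s)" using D[OF assms(3)] .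
  let ?g = "\<lambda>t. vector_derivative f (at t)"
  have "?g differentiable at s"
    using assms(1,3) by (simp add: C2_differentiable_on_def C1_differentiable_on_eq)
  then have "(?g has_vector_derivative vector_derivative ?g (at s)) (at s)"
    by (simp only: vector_derivative_works)
  then have "(deriv f has_vector_derivative vector_derivative ?g (at s)) (at s)"
    by (rule has_vector_derivative_transform_within_open[OF _ assms(2,3) eq])
  then have d: "(deriv f has_real_derivative vector_derivative ?g (at s)) (at s)"
    by (simp only: has_real_derivative_iff_has_vector_derivative)
  show "(deriv f has_real_derivative deriv (deriv f) s) (at s)"
    using d DERIV_imp_deriv[OF d] by simp
qed

text \<open>The fundamental theorem is applied on a compact interval inside \<open>I\<close> that
  contains \<open>c\<close> and has \<open>s\<close> in its interior; there the one-set derivative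
  is the full derivative.\<close>

lemma interval_integral_has_real_derivative_on_interval:
  fixes f :: "real \<Rightarrow> real"
  assumes "open I" "is_interval I" "c \<in> I" "continuous_on I f" "s \<in> I"
  shows "((\<lambda>u. LBINT t=ereal c..ereal u. f t) has_real_derivative f s) (at s)"
proof -
  obtain e where "e > 0" and e: "cball s e \<subseteq> I"
    using assms(5) open_contains_cball_eq[OF assms(1)] by auto
  define l r where "l = min c (s - e)" and "r = max c (s + e)"
  have I: "l \<in> I" "r \<in> I"
    using e \<open>e > 0\<close> assms(3) by (auto simp: l_def r_def min_def max_def dist_real_def subset_iff)
  then have sub: "{l..r} \<subseteq> I"
    using assms(2) by (meson atLeastAtMost_iff is_interval_1 subsetI)
  have "((\<lambda>u. LBINT t=c..u. f t) has_vector_derivative f s) (at s within {l..r})"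
    by (rule interval_integral_FTC2)
      (use \<open>e > 0\<close> continuous_on_subset[OF assms(4) sub] in \<open>auto simp: l_def r_def\<close>)
  moreover have "at s within {l..r} = at s"
    by (rule at_within_interior) (use \<open>e > 0\<close> in \<open>auto simp: l_def r_def\<close>)
  ultimately show ?thesis
    by (simp add: has_real_derivative_iff_has_vector_derivative)
qed

text \<open>The integral is oriented, so \<open>s\<close> may lie on either side of
  \<open>c\<close>; in both cases the closed interval between them stays inside
  \<open>I\<close>.\<close>

lemma interval_integral_FTC_on_interval:
  fixes f F :: "real \<Rightarrow> real"
  assumes "is_interval I" "c \<in> I" "s \<in> I" "continuous_on I f"
    and "\<And>t. t \<in> I \<Longrightarrow> (F has_real_derivative f t) (at t)"
  shows "(LBINT t=ereal c..ereal s. f t) = F s - F c"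
proof (rule interval_integral_FTC_finite)
  have "min c s \<in> I" "max c s \<in> I" using assms(2,3) by (simp_all add: min_def max_def)
  then have sub: "{min c s..max c s} \<subseteq> I"
    using assms(1) by (meson atLeastAtMost_iff is_interval_1 subsetI)
  show "continuous_on {min c s..max c s} f"
    using continuous_on_subset[OF assms(4) sub] .
  show "(F has_vector_derivative f t) (at t within {min c s..max c s})"
    if "min c s \<le> t" "t \<le> max c s" for t
  proof -
    have "t \<in> I" using that sub by auto
    then show ?thesis
      using assms(5) has_vector_derivative_at_within
      unfolding has_real_derivative_iff_has_vector_derivative by blast
  qed
qed

text \<open>Serves to replace the square root expression by y - z under an integral, the two being
  equal on \<open>I\<close>.\<close>

lemma interval_integral_cong_on_interval:
  fixes f g :: "real \<Rightarrow> real"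
  assumes "is_interval I" "c \<in> I" "s \<in> I" "\<And>t. t \<in> I \<Longrightarrow> f t = g t"
  shows "(LBINT t=ereal c..ereal s. f t) = (LBINT t=ereal c..ereal s. g t)"
proof (rule interval_integral_cong)
  fix t assume "t \<in> einterval (min (ereal c) (ereal s)) (max (ereal c) (ereal s))"
  then have "min c s \<le> t" "t \<le> max c s"
    by (auto simp: einterval_iff min_def max_def split: if_splits)
  moreover have "min c s \<in> I" "max c s \<in> I" using assms(2,3) by (simp_all add: min_def max_def)
  ultimately have "t \<in> I"
    using assms(1) by (meson is_interval_1)
  then show "f t = g t" using assms(4) by blast
qed

text \<open>At \<theta> = 0 the tangent vectors are (0, y', z') and (y - z, 0, 0), and the normal is
  (0, z', y'). Hence g11 = \<eta>, g12 = 0, g22 = (y - z)^2 and the sign eps is -\<eta>; the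
  vanishing of g12 removes the mixed term.\<close>

lemma mean_curvature_lightlike_rotation:
  assumes "open I" "s \<in> I"
    and y: "y C2_differentiable_on I" and z: "z C2_differentiable_on I"
    and pos: "y s > z s" and unit: "(deriv y s)\<^sup>2 - (deriv z s)\<^sup>2 = \<eta>" and "\<eta>\<^sup>2 = 1"
  shows "mean_curvature (lightlike_rotation_surface y z) (lightlike_rotation_normal y z) s 0
    = - (1 / 2) * (\<eta> * (deriv y s - deriv z s) / (y s - z s)
        + (deriv (deriv y) s * deriv z s - deriv y s * deriv (deriv z) s))"
proof -
  let ?X = "lightlike_rotation_surface y z"
  note dy = C2_differentiable_on_real_derivatives[OF y \<open>open I\<close>]
  note dz = C2_differentiable_on_real_derivatives[OF z \<open>open I\<close>]
  have X1: "partial1 ?X t 0 = vector [0, deriv y t, deriv z t]" if "t \<in> I" for t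
    unfolding partial1_def lightlike_rotation_surface_def
    by (rule vector_derivative_at, rule has_vector_derivative_vector_3)
      (auto intro!: derivative_eq_intros dy(1) dz(1) that)
  have "((\<lambda>t. vector [0, deriv y t, deriv z t] :: real ^ 3) has_vector_derivative
      vector [0, deriv (deriv y) s, deriv (deriv z) s]) (at s)"
    by (rule has_vector_derivative_vector_3) (auto intro!: dy(2) dz(2) assms(2))
  then have "((\<lambda>t. partial1 ?X t 0) has_vector_derivative
      vector [0, deriv (deriv y) s, deriv (deriv z) s]) (at s)"
    by (rule has_vector_derivative_transform_within_open[OF _ assms(1,2)]) (simp add: X1)
  then have X11: "partial1 (partial1 ?X) s 0 = vector [0, deriv (deriv y) s, deriv (deriv z) s]"
    unfolding partial1_def[of "partial1 ?X"] by (rule vector_derivative_at)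
  \<comment> \<open>This is computed for every \<theta>, because it is differentiated once more in
    \<theta> to get \<open>X22\<close>.\<close>
  have X2: "partial2 ?X s \<theta> = vector [y s - z s, - \<theta> * (y s - z s), - \<theta> * (y s - z s)]" for \<theta>
    unfolding partial2_def lightlike_rotation_surface_def
    by (rule vector_derivative_at, rule has_vector_derivative_vector_3)
      (auto intro!: derivative_eq_intros)
  have X22: "partial2 (partial2 ?X) s 0 = vector [0, - (y s - z s), - (y s - z s)]"
    unfolding partial2_def[of "partial2 ?X"] X2
    by (rule vector_derivative_at, rule has_vector_derivative_vector_3)
      (auto intro!: derivative_eq_intros)
  define a where "a = y s - z s"
  have "a \<noteq> 0" using pos by (simp add: a_def)
  have "\<eta> \<noteq> 0" using \<open>\<eta>\<^sup>2 = 1\<close> by auto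
  define p q where "p = deriv y s" and "q = deriv z s"
  define p' q' where "p' = deriv (deriv y) s" and "q' = deriv (deriv z) s"
  have "mean_curvature ?X (lightlike_rotation_normal y z) s 0
      = (q\<^sup>2 - p\<^sup>2) / 2 * (((p\<^sup>2 - q\<^sup>2) * (a * p - a * q) + a\<^sup>2 * (p' * q - q' * p)) / ((p\<^sup>2 - q\<^sup>2) * a\<^sup>2))"
    unfolding mean_curvature_def Let_def X1[OF assms(2)] X2 X11 X22
      lightlike_rotation_normal_def lorentz_inner_def
    by (simp add: a_def p_def q_def p'_def q'_def power2_eq_square algebra_simps)
  also have "p\<^sup>2 - q\<^sup>2 = \<eta>" using unit by (simp add: p_def q_def)
  also have "q\<^sup>2 - p\<^sup>2 = - \<eta>" using unit by (simp add: p_def q_def)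
  also have "- \<eta> / 2 * ((\<eta> * (a * p - a * q) + a\<^sup>2 * (p' * q - q' * p)) / (\<eta> * a\<^sup>2))
      = - (1 / 2) * (\<eta> * (p - q) / a + (p' * q - p * q'))"
    using \<open>a \<noteq> 0\<close> \<open>\<eta> \<noteq> 0\<close> by (simp add: field_simps power2_eq_square)
  finally show ?thesis by (simp add: a_def p_def q_def p'_def q'_def)
qed

text \<open>The fourth assumption is the derivative of \<open>a' * b' = \<eta>\<close>; it collapses
  the bracket in \<open>H\<close> to \<open>a'' * b'\<close>. Multiplying by
  \<open>- 2 * \<eta> * (a * a')\<close> and using \<open>a' * b' = \<eta>\<close> leaves the
  derivative of \<open>a * a'\<close>.\<close>

lemma null_coordinate_ode:
  fixes a b a' b' a'' b'' \<eta> H :: real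
  assumes "a \<noteq> 0" "a' * b' = \<eta>" "\<eta>\<^sup>2 = 1" "a'' * b' + a' * b'' = 0"
    and H: "H = - (1 / 2) * (\<eta> * a' / a + (a'' * b' - a' * b'') / 2)"
  shows "a' * a' + a * a'' = - 2 * \<eta> * H * (a * a')"
proof -
  have "a'' * b' - a' * b'' = 2 * (a'' * b')" using assms(4) by simp
  then have "H = - (1 / 2) * (\<eta> * a' / a + a'' * b')" using H by simp
  then have "- 2 * \<eta> * H * (a * a') = \<eta> * (\<eta> * a' / a + a'' * b') * (a * a')"
    by simp
  also have "\<dots> = \<eta>\<^sup>2 * (a' * a') * (a / a) + a * a'' * \<eta> * (a' * b')"
    by (simp add: algebra_simps power2_eq_square)
  also have "\<dots> = a' * a' + a * a'' * \<eta>\<^sup>2"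
    unfolding assms(2) using assms(1,3) by (simp add: power2_eq_square mult.assoc)
  finally show ?thesis using assms(3) by simp
qed

theorem mainTheorem5:
  fixes \<eta> :: real and I :: "real set" and y z H :: "real \<Rightarrow> real"
  assumes "\<eta> \<in> {-1, 1}"
    and "open I" and "is_interval I" and "0 \<in> I"
    and "y C2_differentiable_on I" and "z C2_differentiable_on I"
    and "\<And>s. s \<in> I \<Longrightarrow> y s > z s"
    and "\<And>s. s \<in> I \<Longrightarrow> (deriv y s)\<^sup>2 - (deriv z s)\<^sup>2 = \<eta>"
    and "continuous_on I H"
    and "\<And>s \<theta>. s \<in> I \<Longrightarrow>
           mean_curvature (lightlike_rotation_surface y z) (lightlike_rotation_normal y z) s \<theta> = H s"
  shows "\<exists>a0 a1 b0 b1 :: real.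
    let a = (\<lambda>s::real. sqrt (a1 + a0 *
              (LBINT u=0..ereal s. exp (- 2 * \<eta> * (LBINT t=0..ereal u. H t)))))
    in \<forall>s\<in>I.
        y s = 1 / 2 * (b1 + a s + b0 *
              (LBINT u=0..ereal s. a u * exp (2 * \<eta> * (LBINT t=0..ereal u. H t)))) \<and>
        z s = 1 / 2 * (b1 - a s + b0 *
              (LBINT u=0..ereal s. a u * exp (2 * \<eta> * (LBINT t=0..ereal u. H t))))"
proof -
  have \<eta>: "\<eta>\<^sup>2 = 1" "\<eta> \<noteq> 0" using assms(1) by auto
  note dy = C2_differentiable_on_real_derivatives[OF assms(5,2)]
  note dz = C2_differentiable_on_real_derivatives[OF assms(6,2)]
  define a b where "a = (\<lambda>s. y s - z s)" and "b = (\<lambda>s. y s + z s)"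
  define a' b' where "a' = (\<lambda>s. deriv y s - deriv z s)" and "b' = (\<lambda>s. deriv y s + deriv z s)"
  define a'' b'' where "a'' = (\<lambda>s. deriv (deriv y) s - deriv (deriv z) s)"
    and "b'' = (\<lambda>s. deriv (deriv y) s + deriv (deriv z) s)"
  have der:
    "(a has_real_derivative a' s) (at s)" "(b has_real_derivative b' s) (at s)"
    "(a' has_real_derivative a'' s) (at s)" "(b' has_real_derivative b'' s) (at s)" if "s \<in> I" for s
    unfolding a_def b_def a'_def b'_def a''_def b''_def
    by (auto intro!: derivative_intros dy dz that)
  have apos: "a s > 0" if "s \<in> I" for s using assms(7)[OF that] by (simp add: a_def)
  have ab: "a' s * b' s = \<eta>" if "s \<in> I" for s
    using assms(8)[OF that] by (simp add: a'_def b'_def power2_eq_square algebra_simps)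
  \<comment> \<open>The product \<open>a' * b'\<close> is constant on the open set \<open>I\<close>,
    so its derivative by the product rule must be 0.\<close>
  have ab': "a'' s * b' s + a' s * b'' s = 0" if "s \<in> I" for s
  proof (rule DERIV_unique)
    show "((\<lambda>t. a' t * b' t) has_real_derivative a'' s * b' s + a' s * b'' s) (at s)"
      by (auto intro!: derivative_eq_intros der that)
    show "((\<lambda>t. a' t * b' t) has_real_derivative 0) (at s)"
      by (rule has_field_derivative_transform_within_open[OF DERIV_const assms(2) that])
        (simp add: ab)
  qed
  have ode: "a' s * a' s + a s * a'' s = - 2 * \<eta> * H s * (a s * a' s)" if s: "s \<in> I" for s
  proof (rule null_coordinate_ode[OF _ ab[OF s] \<eta>(1) ab'[OF s]])
    show "a s \<noteq> 0" using apos[OF s] by simp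
    show "H s = - (1 / 2) * (\<eta> * a' s / a s + (a'' s * b' s - a' s * b'' s) / 2)"
      \<comment> \<open>The curvature is read off at \<theta> = 0. In null coordinates y'' z' - y'
        z'' is half of \<open>a'' b' - a' b''\<close>.\<close>
      unfolding assms(10)[OF s, of 0, symmetric]
        mean_curvature_lightlike_rotation[OF assms(2) s assms(5,6) assms(7,8)[OF s] \<eta>(1)]
      by (simp add: a_def a'_def b'_def a''_def b''_def field_simps)
  qed
  define G where "G = (\<lambda>u. LBINT t=0..ereal u. H t)"
  have dG: "(G has_real_derivative H s) (at s)" if "s \<in> I" for s
    \<comment> \<open>The lower limit of \<open>G\<close> is the zero of \<open>ereal\<close>;
      \<open>zero_ereal_def\<close> matches it with the real base point.\<close>
    using interval_integral_has_real_derivative_on_interval[OF assms(2,3,4,9) that]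
    by (simp add: G_def zero_ereal_def)
  have cont: "continuous_on I f" if "\<And>s. s \<in> I \<Longrightarrow> (f has_real_derivative f' s) (at s)" for f f'
    using that by (meson DERIV_continuous_on has_field_derivative_at_within)
  \<comment> \<open>The linear equation for \<open>a * a'\<close> is solved by the integrating
    factor \<open>exp (2 * \<eta> * G s)\<close>, which avoids a logarithm and the sign of
    \<open>a'\<close>.\<close>
  have "\<exists>c. \<forall>s\<in>I. a s * a' s * exp (2 * \<eta> * G s) = c"
  proof (rule has_field_derivative_zero_constant)
    show "convex I" using assms(3) is_interval_convex by blast
    show "((\<lambda>s. a s * a' s * exp (2 * \<eta> * G s)) has_real_derivative 0) (at s within I)"
      if s: "s \<in> I" for s
    proof -
      have "((\<lambda>s. a s * a' s * exp (2 * \<eta> * G s)) has_real_derivative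
          (a' s * a' s + a s * a'' s + 2 * \<eta> * H s * (a s * a' s)) * exp (2 * \<eta> * G s)) (at s)"
        by (auto intro!: derivative_eq_intros der dG s simp: algebra_simps)
      then show ?thesis using ode[OF s] by (auto intro: has_field_derivative_at_within)
    qed
  qed
  then obtain c where c: "\<And>s. s \<in> I \<Longrightarrow> a s * a' s * exp (2 * \<eta> * G s) = c" by blast
  \<comment> \<open>At 0, \<open>a\<close> is positive, and \<open>a'\<close> cannot vanish because
    \<open>a' * b' = \<eta>\<close> is nonzero.\<close>
  have "c \<noteq> 0" using c[OF assms(4)] ab[OF assms(4)] apos[OF assms(4)] \<eta>(2) by auto
  have aa': "a s * a' s = c * exp (- 2 * \<eta> * G s)" if "s \<in> I" for s
    using c[OF that] by (auto simp: exp_minus field_simps)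
  have b': "b' s = \<eta> / c * (a s * exp (2 * \<eta> * G s))" if "s \<in> I" for s
  proof -
    \<comment> \<open>Multiply \<open>a' * b' = \<eta>\<close> by
      \<open>a * exp (2 * \<eta> * G)\<close> and recognise \<open>c\<close> on the left.\<close>
    have "c * b' s = \<eta> * (a s * exp (2 * \<eta> * G s))"
      using ab[OF that] c[OF that] by (metis mult.assoc mult.commute)
    then show ?thesis using \<open>c \<noteq> 0\<close> by (simp add: field_simps)
  qed
  have cG: "continuous_on I G" and ca: "continuous_on I a" by (rule cont, erule dG der)+
  \<comment> \<open>Since (a^2)' = 2 a a', the constants of the square root are
    \<open>a1 = (a 0)^2\<close> and \<open>a0 = 2 * c\<close>. Positivity of \<open>a\<close>
    selects the nonnegative root.\<close>
  define A where "A = (\<lambda>s. sqrt ((a 0)\<^sup>2 + 2 * c * (LBINT u=0..ereal s. exp (- 2 * \<eta> * G u))))"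
  have A: "A s = a s" if s: "s \<in> I" for s
  proof -
    have "(LBINT u=ereal 0..ereal s. exp (- 2 * \<eta> * G u)) = (a s)\<^sup>2 / (2 * c) - (a 0)\<^sup>2 / (2 * c)"
    proof (rule interval_integral_FTC_on_interval[OF assms(3,4) s])
      show "continuous_on I (\<lambda>u. exp (- 2 * \<eta> * G u))" by (intro continuous_intros cG)
      show "((\<lambda>t. (a t)\<^sup>2 / (2 * c)) has_real_derivative exp (- 2 * \<eta> * G t)) (at t)" if "t \<in> I" for t
        using aa'[OF that] \<open>c \<noteq> 0\<close>
        by (auto intro!: derivative_eq_intros der that simp: field_simps)
    qed
    then show ?thesis using apos[OF s] \<open>c \<noteq> 0\<close> by (simp add: A_def zero_ereal_def field_simps)
  qed
  have B: "b s = b 0 + \<eta> / c * (LBINT u=0..ereal s. A u * exp (2 * \<eta> * G u))" if s: "s \<in> I" for s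
  proof -
    \<comment> \<open>With \<open>A\<close> replaced by \<open>a\<close>, the integrand has the
      antiderivative \<open>c / \<eta> * b\<close> by the formula for \<open>b'\<close>. This gives
      \<open>b0 = \<eta> / c\<close> and \<open>b1 = b 0\<close>.\<close>
    have "(LBINT u=ereal 0..ereal s. A u * exp (2 * \<eta> * G u))
        = (LBINT u=ereal 0..ereal s. a u * exp (2 * \<eta> * G u))"
      by (rule interval_integral_cong_on_interval[OF assms(3,4) s]) (simp add: A)
    also have "\<dots> = c / \<eta> * b s - c / \<eta> * b 0"
    proof (rule interval_integral_FTC_on_interval[OF assms(3,4) s])
      show "continuous_on I (\<lambda>u. a u * exp (2 * \<eta> * G u))" by (intro continuous_intros cG ca)
      show "((\<lambda>t. c / \<eta> * b t) has_real_derivative a t * exp (2 * \<eta> * G t)) (at t)" if "t \<in> I" for t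
        using b'[OF that] \<open>c \<noteq> 0\<close> \<eta>(2)
        by (auto intro!: derivative_eq_intros der that simp: field_simps)
    qed
    finally show ?thesis using \<open>c \<noteq> 0\<close> \<eta>(2) by (simp add: zero_ereal_def field_simps)
  qed
  have "\<forall>s\<in>I.
      y s = 1 / 2 * (b 0 + A s + \<eta> / c * (LBINT u=0..ereal s. A u * exp (2 * \<eta> * G u))) \<and>
      z s = 1 / 2 * (b 0 - A s + \<eta> / c * (LBINT u=0..ereal s. A u * exp (2 * \<eta> * G u)))"
  proof
    fix s assume s: "s \<in> I"
    have "y s = 1 / 2 * (b s + a s)" "z s = 1 / 2 * (b s - a s)" by (simp_all add: a_def b_def)
    then show "y s = 1 / 2 * (b 0 + A s + \<eta> / c * (LBINT u=0..ereal s. A u * exp (2 * \<eta> * G u))) \<and>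
      z s = 1 / 2 * (b 0 - A s + \<eta> / c * (LBINT u=0..ereal s. A u * exp (2 * \<eta> * G u)))"
      using A[OF s] B[OF s] by (simp add: algebra_simps)
  qed
  then show ?thesis
    unfolding Let_def A_def G_def by blast
qed

end
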